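(* For every integer $n\ge 3$ and every integer $\ell\ge 1$, there exist $K_n$-WORM colorable graphs whose $K_n$-WORM chromatic spectrum contains a gap of size $\ell$.
   Context: All graphs are finite and simple; $K_n$ is the complete graph on $n$ vertices. For graphs $F$ and $G$, an $F$-WORM coloring of $G$ is an assignment of colors to the vertices of $G$ such that no subgraph of $G$ isomorphic to $F$ is monochromatic (all its vertices have the same color) or rainbow (its vertices have pairwise distinct colors). For an $F$-WORM colorable $G$, $W^-(G,F)$ and $W^+(G,F)$ are the minimum and maximum numbers of colors in an $F$-WORM coloring of $G$, and the $F$-WORM feasible set (chromatic spectrum) $\Phi_W(G,F)$ is the set of integers $s$ such that $G$ has an $F$-WORM coloring using exactly $s$ colors. $G$ has a gap at $k$ if $W^-(G,F)<k<W^+(G,F)$ and $k\notin\Phi_W(G,F)$; the size of a gap is the number of consecutive integers missing from $\Phi_W(G,F)$ (i.e., a gap of size $\ell$ is a maximal run of $\ell$ consecutive integers strictly between $W^-(G,F)$ and $W^+(G,F)$ none of which lies in $\Phi_W(G,F)$). *)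

theory Defs
  imports "Graph_Theory.Graph_Theory"
begin

text \<open>
  A finite simple graph is a finite symmetric digraph without loops and parallel arcs
  (locale \<open>graph\<close>): each undirected edge is a pair of opposite arcs. A subdigraph isomorphic
  to such a graph is itself symmetric, so \<open>subgraph\<close> and \<open>digraph_iso\<close> give
  the undirected notion of a copy of \<open>F\<close> in \<open>G\<close>.
\<close>

definition complete_graph :: "nat \<Rightarrow> (nat, nat \<times> nat) pre_digraph" where
  "complete_graph n =
     with_proj \<lparr>pverts = {..<n}, parcs = {(u, v). u < n \<and> v < n \<and> u \<noteq> v}\<rparr>"

lemma complete_digraph_complete_graph: "complete_digraph n (complete_graph n)"
  unfolding complete_graph_def complete_digraph_pair_def by auto

definition monochromatic :: "('a, 'b) pre_digraph \<Rightarrow> ('a \<Rightarrow> 'c) \<Rightarrow> bool" where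
  "monochromatic H c \<longleftrightarrow> (\<forall>u \<in> verts H. \<forall>v \<in> verts H. c u = c v)"

definition rainbow :: "('a, 'b) pre_digraph \<Rightarrow> ('a \<Rightarrow> 'c) \<Rightarrow> bool" where
  "rainbow H c \<longleftrightarrow> inj_on c (verts H)"

definition worm_coloring ::
    "('a, 'b) pre_digraph \<Rightarrow> ('f, 'e) pre_digraph \<Rightarrow> ('a \<Rightarrow> nat) \<Rightarrow> bool" where
  "worm_coloring G F c \<longleftrightarrow>
     (\<forall>H. subgraph H G \<and> digraph_iso F H \<longrightarrow> \<not> monochromatic H c \<and> \<not> rainbow H c)"

definition worm_colorable :: "('a, 'b) pre_digraph \<Rightarrow> ('f, 'e) pre_digraph \<Rightarrow> bool" where
  "worm_colorable G F \<longleftrightarrow> (\<exists>c. worm_coloring G F c)"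

definition worm_spectrum :: "('a, 'b) pre_digraph \<Rightarrow> ('f, 'e) pre_digraph \<Rightarrow> nat set" where
  "worm_spectrum G F = {s. \<exists>c. worm_coloring G F c \<and> card (c ` verts G) = s}"

lemma finite_worm_spectrum:
  assumes "graph G"
  shows "finite (worm_spectrum G F)"
proof -
  interpret graph G by fact
  have "worm_spectrum G F \<subseteq> {..card (verts G)}"
    unfolding worm_spectrum_def by (auto intro: card_image_le)
  then show ?thesis
    by (rule finite_subset) simp
qed

lemma worm_spectrum_nonempty_iff: "worm_spectrum G F \<noteq> {} \<longleftrightarrow> worm_colorable G F"
  unfolding worm_spectrum_def worm_colorable_def by auto

definition worm_min :: "('a, 'b) pre_digraph \<Rightarrow> ('f, 'e) pre_digraph \<Rightarrow> nat" where
  "worm_min G F = Min (worm_spectrum G F)"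

definition worm_max :: "('a, 'b) pre_digraph \<Rightarrow> ('f, 'e) pre_digraph \<Rightarrow> nat" where
  "worm_max G F = Max (worm_spectrum G F)"

definition gap_at :: "('a, 'b) pre_digraph \<Rightarrow> ('f, 'e) pre_digraph \<Rightarrow> nat \<Rightarrow> bool" where
  "gap_at G F k \<longleftrightarrow> worm_min G F < k \<and> k < worm_max G F \<and> k \<notin> worm_spectrum G F"

text \<open>
  The run is \<open>k + 1, \<dots>, k + l\<close>, and the last two conjuncts make it maximal. Every
  gap value is positive, so starting the run at \<open>k + 1\<close> with \<open>k\<close> a natural
  number loses nothing.
\<close>

definition has_gap_of_size ::
    "('a, 'b) pre_digraph \<Rightarrow> ('f, 'e) pre_digraph \<Rightarrow> nat \<Rightarrow> bool" where
  "has_gap_of_size G F l \<longleftrightarrow>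
     (\<exists>k. (\<forall>i \<in> {k<..k + l}. gap_at G F i) \<and> \<not> gap_at G F k \<and> \<not> gap_at G F (k + l + 1))"

end

theory Submission
  imports Defs "HOL-Library.Countable"
begin

text \<open>
  Put \<open>k = n - 1\<close>. A clique on \<open>k\<^sup>2\<close> vertices admits only the \<open>K\<^sub>n\<close>-WORM
  colourings with exactly \<open>k\<close> colour classes, all of size \<open>k\<close>. Take a connected
  triangle-free graph \<open>G\<close> of large chromatic number (a shift graph), join it with
  \<open>K\<^bsub>k - 2\<^esub>\<close>, and replace every vertex by a copy of \<open>K\<^sub>k\<close>. The maximal cliques
  now have \<open>k\<^sup>2\<close> vertices and correspond to the edges of \<open>G\<close>. If a colour outside the core
  (the blown-up \<open>K\<^bsub>k - 2\<^esub>\<close>) covers a blob only partly, then so it does on every adjacent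
  blob, hence everywhere, and \<open>k\<close> colours are used in total. Otherwise each blob is monochromatic
  in a colour outside the core, or uses core colours only. The second kind of blob
  can only occur if \<open>G\<close> is bipartite or the core already uses \<open>k\<close> colours; without it the
  colouring is a proper colouring of \<open>G\<close> and uses at least \<open>k - 2 + \<chi>(G)\<close> colours.
  So there is an arbitrarily long gap directly above \<open>k\<close>, and each isolated vertex added to the
  graph replaces the spectrum \<open>S\<close> by \<open>S \<union> (S + 1)\<close>, shortening the gap by one.
\<close>

section \<open>Colourings of cliques\<close>

text \<open>Stated for a bare relation, so that the combinatorics need not mention arcs or
  isomorphisms; \<open>worm_coloring_with_proj_iff\<close> is the bridge to digraphs.\<close>

definition clique :: "('a \<times> 'a) set \<Rightarrow> nat \<Rightarrow> 'a set \<Rightarrow> bool" where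
  "clique E n K \<longleftrightarrow> finite K \<and> card K = n \<and> (\<forall>u \<in> K. \<forall>v \<in> K. u \<noteq> v \<longrightarrow> (u, v) \<in> E)"

definition clique_worm :: "('a \<times> 'a) set \<Rightarrow> nat \<Rightarrow> ('a \<Rightarrow> nat) \<Rightarrow> bool" where
  "clique_worm E n c \<longleftrightarrow>
     (\<forall>K. clique E n K \<longrightarrow> \<not> (\<forall>u \<in> K. \<forall>v \<in> K. c u = c v) \<and> \<not> inj_on c K)"

definition clique_spectrum :: "'a set \<Rightarrow> ('a \<times> 'a) set \<Rightarrow> nat \<Rightarrow> nat set" where
  "clique_spectrum V E n = {card (c ` V) | c. clique_worm E n c}"

section \<open>Copies of the complete graph as cliques\<close>

lemma clique_subset_verts:
  assumes "clique E n K" "n \<ge> 2" "E \<subseteq> V \<times> V"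
  shows "K \<subseteq> V"
proof
  fix u assume "u \<in> K"
  moreover have "\<not> K \<subseteq> {u}"
    using assms card_mono[of "{u}" K] unfolding clique_def by fastforce
  ultimately show "u \<in> V"
    using assms unfolding clique_def by blast
qed

lemma graph_with_projI:
  assumes "finite V" "E \<subseteq> V \<times> V" "sym E" "irrefl E"
  shows "graph (with_proj \<lparr>pverts = V, parcs = E\<rparr>)"
proof -
  have "finite E"
    using assms finite_subset by blast
  then show ?thesis
    using assms
    by unfold_locales
      (auto simp: arc_to_ends_def symmetric_def sym_def irrefl_def)
qed

text \<open>Compatibility with the host forces the tail and head maps of \<open>H\<close> to be
  \<open>fst\<close> and \<open>snd\<close>, so the image of the arc \<open>(i, j)\<close> is the
  pair of the image vertices and lies in \<open>E\<close>.\<close>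

lemma clique_of_complete_subgraph:
  assumes "subgraph H (with_proj \<lparr>pverts = V, parcs = E\<rparr>)" "digraph_iso (complete_graph n) H"
  shows "clique E n (verts H)"
proof -
  obtain f where f: "pre_digraph.digraph_isomorphism (complete_graph n) f"
    and H: "H = app_iso f (complete_graph n)"
    using assms(2) unfolding digraph_iso_def by blast
  have inj: "inj_on (iso_verts f) {..<n}"
    and ends: "\<And>i j. i < n \<Longrightarrow> j < n \<Longrightarrow> i \<noteq> j \<Longrightarrow>
        iso_verts f i = iso_tail f (iso_arcs f (i, j)) \<and>
        iso_verts f j = iso_head f (iso_arcs f (i, j))"
    using f unfolding pre_digraph.digraph_isomorphism_def complete_graph_def by auto
  have vH: "verts H = iso_verts f ` {..<n}"
    unfolding H by (simp add: verts_app_iso complete_graph_def)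
  have "(iso_verts f i, iso_verts f j) \<in> E" if "i < n" "j < n" "i \<noteq> j" for i j
  proof -
    have "iso_arcs f (i, j) \<in> arcs H"
      using that unfolding H by (auto simp: arcs_app_iso complete_graph_def)
    moreover have "iso_tail f = fst" "iso_head f = snd"
      using assms(1) unfolding subgraph_def compatible_def H
      by (auto simp: tail_app_iso head_app_iso)
    ultimately show ?thesis
      using ends[OF that] assms(1) unfolding subgraph_def by auto
  qed
  then show ?thesis
    unfolding clique_def vH using inj by (auto simp: card_image)
qed

lemma complete_subgraph_of_clique:
  assumes "clique E n K" "K \<subseteq> V" "E \<subseteq> V \<times> V"
  shows "\<exists>H. verts H = K \<and> subgraph H (with_proj \<lparr>pverts = V, parcs = E\<rparr>) \<and>
    digraph_iso (complete_graph n) H"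
proof -
  obtain h where h: "bij_betw h {..<n} K"
    using assms(1) unfolding clique_def
    by (metis card_lessThan finite_lessThan finite_same_card_bij)
  then have inj: "inj_on h {..<n}" and im: "h ` {..<n} = K"
    by (auto simp: bij_betw_def)
  \<comment> \<open>Arcs of the host are pairs, so a compatible copy must relabel arcs
    componentwise.\<close>
  define f where "f = \<lparr>iso_verts = h, iso_arcs = map_prod h h, iso_head = snd, iso_tail = fst\<rparr>"
  let ?H = "app_iso f (complete_graph n)"
  have iso: "pre_digraph.digraph_isomorphism (complete_graph n) f"
    unfolding pre_digraph.digraph_isomorphism_def complete_graph_def f_def
    using inj by (auto simp: wf_digraph_def inj_on_def)
  have vH: "verts ?H = K"
    using im by (simp add: verts_app_iso complete_graph_def f_def)
  have aH: "arcs ?H \<subseteq> E \<inter> K \<times> K"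
  proof -
    have "(h i, h j) \<in> E" if "i < n" "j < n" "i \<noteq> j" for i j
      using assms(1) im inj that unfolding clique_def
      by (metis imageI inj_onD lessThan_iff)
    then show ?thesis
      using im by (auto simp: arcs_app_iso complete_graph_def f_def)
  qed
  have "subgraph ?H (with_proj \<lparr>pverts = V, parcs = E\<rparr>)"
    unfolding subgraph_def compatible_def
    using vH aH assms
    by (auto simp: wf_digraph_def tail_app_iso head_app_iso f_def)
  then show ?thesis
    using vH iso unfolding digraph_iso_def by blast
qed

lemma worm_coloring_with_proj_iff:
  assumes "n \<ge> 2" "E \<subseteq> V \<times> V"
  shows "worm_coloring (with_proj \<lparr>pverts = V, parcs = E\<rparr>) (complete_graph n) c \<longleftrightarrow>
    clique_worm E n c"
  using clique_of_complete_subgraph[of _ V E n] complete_subgraph_of_clique[of E n _ V]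
    clique_subset_verts[of E n _ V] assms
  unfolding worm_coloring_def clique_worm_def monochromatic_def rainbow_def
  by metis

lemma worm_spectrum_with_proj:
  assumes "n \<ge> 2" "E \<subseteq> V \<times> V"
  shows "worm_spectrum (with_proj \<lparr>pverts = V, parcs = E\<rparr>) (complete_graph n) =
    clique_spectrum V E n"
  unfolding worm_spectrum_def clique_spectrum_def worm_coloring_with_proj_iff[OF assms] by auto

text \<open>The new vertex is isolated and lies in no clique on two or more vertices, so its colour
  is free: it repeats an old colour, available since \<open>V\<close> is nonempty, or takes a fresh
  one.\<close>

lemma clique_spectrum_insert:
  assumes "finite V" "v \<notin> V" "E \<subseteq> V \<times> V" "n \<ge> 2" "V \<noteq> {}"
  shows "clique_spectrum (insert v V) E n = clique_spectrum V E n \<union> Suc ` clique_spectrum V E n"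
    (is "?L = ?S \<union> _")
proof (intro equalityI subsetI)
  fix s assume "s \<in> ?L"
  then obtain c where "clique_worm E n c" "s = card (insert (c v) (c ` V))"
    unfolding clique_spectrum_def by auto
  then show "s \<in> ?S \<union> Suc ` ?S"
    using assms(1) unfolding clique_spectrum_def by (auto simp: card_insert_if)
next
  fix s assume s: "s \<in> ?S \<union> Suc ` ?S"
  have upd: "clique_worm E n (c(v := a))" if "clique_worm E n c" for c a
  proof -
    have "\<forall>u \<in> K. (c(v := a)) u = c u" if "clique E n K" for K
      using clique_subset_verts[OF that assms(4,3)] assms(2) by auto
    then show ?thesis
      using \<open>clique_worm E n c\<close> unfolding clique_worm_def
      by (metis inj_on_cong)
  qed
  have im: "card (c(v := a) ` insert v V) = card (insert a (c ` V))" for c :: "'a \<Rightarrow> nat" and a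
  proof -
    have "c(v := a) ` insert v V = insert a (c ` V)"
      using assms(2) by auto
    then show ?thesis by simp
  qed
  from s consider c where "clique_worm E n c" "s = card (c ` V)"
    | c where "clique_worm E n c" "s = Suc (card (c ` V))"
    unfolding clique_spectrum_def by auto
  then show "s \<in> ?L"
  proof cases
    case 1
    obtain w where "w \<in> V" using assms(5) by auto
    then have "card (insert (c w) (c ` V)) = s"
      using 1 by (simp add: insert_absorb)
    then show ?thesis
      unfolding clique_spectrum_def using upd[OF 1(1)] im[of c "c w"]
      by (intro CollectI exI[of _ "c(v := c w)"]) simp
  next
    case 2
    obtain a where "a \<notin> c ` V"
      using assms(1) ex_new_if_finite[of "c ` V"] infinite_UNIV_nat by auto
    then have "card (insert a (c ` V)) = s"
      using 2 assms(1) by simp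
    then show ?thesis
      unfolding clique_spectrum_def using upd[OF 2(1)] im[of c a]
      by (intro CollectI exI[of _ "c(v := a)"]) simp
  qed
qed

text \<open>Allows the blow-up to be moved to natural-number vertices. Colourings are pulled back
  along \<open>f\<close> and pushed forward along \<open>inv f\<close>.\<close>

lemma clique_spectrum_image:
  assumes "inj f" "n \<ge> 2"
  shows "clique_spectrum (f ` V) (map_prod f f ` E) n = clique_spectrum V E n"
proof -
  have cl: "clique (map_prod f f ` E) n (f ` K) \<longleftrightarrow> clique E n K" for K
  proof -
    have "(f u, f v) \<in> map_prod f f ` E \<longleftrightarrow> (u, v) \<in> E" for u v
      using assms(1) by (auto simp: inj_eq)
    moreover have "finite (f ` K) \<longleftrightarrow> finite K" "card (f ` K) = card K"
      using assms(1) by (auto simp: finite_image_iff card_image inj_on_subset)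
    ultimately show ?thesis
      using assms(1) unfolding clique_def by (simp add: inj_eq)
  qed
  have worm: "clique_worm (map_prod f f ` E) n c \<longleftrightarrow> clique_worm E n (c \<circ> f)" for c
  proof -
    have inj: "inj_on c (f ` K) \<longleftrightarrow> inj_on (c \<circ> f) K" for K
      using assms(1) by (meson comp_inj_on_iff inj_on_subset subset_UNIV)
    show ?thesis
      unfolding clique_worm_def
    proof (intro iffI allI impI)
      fix K
      assume worm: "\<forall>K. clique (map_prod f f ` E) n K \<longrightarrow>
          \<not> (\<forall>u \<in> K. \<forall>v \<in> K. c u = c v) \<and> \<not> inj_on c K"
        and "clique E n K"
      then have "\<not> (\<forall>u \<in> f ` K. \<forall>v \<in> f ` K. c u = c v) \<and> \<not> inj_on c (f ` K)"
        using cl[of K] worm by blast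
      then show "\<not> (\<forall>u \<in> K. \<forall>v \<in> K. (c \<circ> f) u = (c \<circ> f) v) \<and> \<not> inj_on (c \<circ> f) K"
        unfolding inj by simp
    next
      fix K
      assume worm: "\<forall>K. clique E n K \<longrightarrow>
          \<not> (\<forall>u \<in> K. \<forall>v \<in> K. (c \<circ> f) u = (c \<circ> f) v) \<and> \<not> inj_on (c \<circ> f) K"
        and K: "clique (map_prod f f ` E) n K"
      have "K \<subseteq> range f"
        by (rule clique_subset_verts[OF K assms(2)]) auto
      then obtain L where L: "K = f ` L"
        by (metis subset_imageE)
      then have "clique E n L" using K cl by simp
      then have "\<not> (\<forall>u \<in> L. \<forall>v \<in> L. (c \<circ> f) u = (c \<circ> f) v) \<and> \<not> inj_on (c \<circ> f) L"
        using worm by blast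
      then show "\<not> (\<forall>u \<in> K. \<forall>v \<in> K. c u = c v) \<and> \<not> inj_on c K"
        unfolding L inj by simp
    qed
  qed
  show ?thesis
  proof (intro equalityI subsetI)
    fix s assume "s \<in> clique_spectrum (f ` V) (map_prod f f ` E) n"
    then obtain c where "clique_worm E n (c \<circ> f)" "s = card (c ` f ` V)"
      unfolding clique_spectrum_def worm by blast
    then show "s \<in> clique_spectrum V E n"
      unfolding clique_spectrum_def image_comp by blast
  next
    fix s assume "s \<in> clique_spectrum V E n"
    then obtain c where c: "clique_worm E n c" "s = card (c ` V)"
      unfolding clique_spectrum_def by blast
    have "(c \<circ> inv f) \<circ> f = c"
      using assms(1) by (auto simp: fun_eq_iff)
    then show "s \<in> clique_spectrum (f ` V) (map_prod f f ` E) n"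
      unfolding clique_spectrum_def worm image_comp using c
      by (intro CollectI exI[of _ "c \<circ> inv f"]) simp
  qed
qed

section \<open>Counting by colour classes\<close>

lemma card_eq_sum_fibres:
  assumes "finite Q"
  shows "card Q = (\<Sum>a \<in> c ` Q. card {p \<in> Q. c p = a})"
  using sum.image_gen[OF assms, of "\<lambda>_. 1::nat" c] by simp

lemma fibres_full:
  assumes "finite Q" "\<And>a. card {p \<in> Q. c p = a} \<le> k" "k * card (c ` Q) \<le> card Q" "a \<in> c ` Q"
  shows "card {p \<in> Q. c p = a} = k"
proof (rule ccontr)
  assume "\<not> ?thesis"
  then have "card {p \<in> Q. c p = a} < k"
    using assms(2)[of a] by simp
  then have "(\<Sum>a \<in> c ` Q. card {p \<in> Q. c p = a}) < (\<Sum>a \<in> c ` Q. k)"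
    using assms by (intro sum_strict_mono_ex1) auto
  then show False
    using assms(1,3) card_eq_sum_fibres[of Q c] by (simp add: mult.commute)
qed

lemma card_le_fibre_bound:
  assumes "finite Q" "\<And>a. card {p \<in> Q. c p = a} \<le> k"
  shows "card Q \<le> k * card (c ` Q)"
  using card_eq_sum_fibres[OF assms(1), of c] sum_bounded_above[of "c ` Q" _ k] assms(2)
  by (simp add: mult.commute)

section \<open>Blowing up a triangle-free graph\<close>

text \<open>
  Every vertex of the join of a graph \<open>(U, R)\<close> with \<open>K\<^bsub>k - 2\<^esub>\<close> is replaced by a clique
  on \<open>k\<close> vertices: \<open>Inl x\<close> is a vertex of the graph, \<open>Inr i\<close> one of
  \<open>K\<^bsub>k - 2\<^esub>\<close>, and the second component numbers the copies.
\<close>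

definition blob :: "nat \<Rightarrow> 'v \<Rightarrow> (('v + nat) \<times> nat) set" where
  "blob k x = {Inl x} \<times> {..<k}"

definition core :: "nat \<Rightarrow> (('v + nat) \<times> nat) set" where
  "core k = Inr ` {..<k - 2} \<times> {..<k}"

definition blowup_verts :: "nat \<Rightarrow> 'v set \<Rightarrow> (('v + nat) \<times> nat) set" where
  "blowup_verts k U = (\<Union>x \<in> U. blob k x) \<union> core k"

lemma blowup_verts_eq: "blowup_verts k U = (Inl ` U \<union> Inr ` {..<k - 2}) \<times> {..<k}"
  by (auto simp: blowup_verts_def blob_def core_def)

text \<open>The condition is vacuous as soon as one end is an \<open>Inr\<close> vertex, which
  yields the join; the alternative \<open>x = y\<close> turns each blob into a clique.\<close>

definition blowup_edges ::
    "nat \<Rightarrow> 'v set \<Rightarrow> ('v \<times> 'v) set \<Rightarrow> ((('v + nat) \<times> nat) \<times> (('v + nat) \<times> nat)) set" where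
  "blowup_edges k U R = {(p, q). p \<in> blowup_verts k U \<and> q \<in> blowup_verts k U \<and> p \<noteq> q \<and>
     (\<forall>x y. fst p = Inl x \<longrightarrow> fst q = Inl y \<longrightarrow> x = y \<or> (x, y) \<in> R)}"

definition edge_clique :: "nat \<Rightarrow> 'v \<Rightarrow> 'v \<Rightarrow> (('v + nat) \<times> nat) set" where
  "edge_clique k x y = blob k x \<union> blob k y \<union> core k"

lemma finite_blob [simp]: "finite (blob k x)"
  and finite_core [simp]: "finite (core k)"
  and finite_edge_clique [simp]: "finite (edge_clique k x y)"
  by (auto simp: blob_def core_def edge_clique_def)

lemma card_blob [simp]: "card (blob k x) = k"
  by (simp add: blob_def card_cartesian_product)

lemma card_core [simp]: "card (core k :: (('v + nat) \<times> nat) set) = k * (k - 2)"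
  by (simp add: core_def card_cartesian_product card_image)

lemma blob_core_disjoint: "blob k x \<inter> core k = {}"
  by (auto simp: blob_def core_def)

lemma blob_blob_disjoint: "x \<noteq> y \<Longrightarrow> blob k x \<inter> blob k y = {}"
  by (auto simp: blob_def)

lemma card_edge_clique:
  assumes "x \<noteq> y" "k \<ge> 2"
  shows "card (edge_clique k x y) = k * k"
proof -
  have "card (edge_clique k x y) = k + k + k * (k - 2)"
    using blob_core_disjoint[of k x] blob_core_disjoint[of k y] blob_blob_disjoint[OF assms(1)]
    unfolding edge_clique_def by (subst card_Un_disjoint; auto simp: card_Un_disjoint)
  also obtain m where "k = m + 2"
    using assms(2) by (metis add.commute le_Suc_ex)
  then have "k + k + k * (k - 2) = k * k"
    by simp
  finally show ?thesis .
qed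

text \<open>The clique of the join that \<open>edge_clique\<close> blows up; it bounds class sizes
  in one sample colouring and the number of colours in the other.\<close>

lemma card_base_clique_le:
  assumes "k \<ge> 2"
  shows "card ({Inl x, Inl y} \<union> Inr ` {..<k - 2} :: ('v + nat) set) \<le> k"
proof -
  have "card ({Inl x, Inl y} \<union> Inr ` {..<k - 2} :: ('v + nat) set) \<le>
      card {Inl x, Inl y :: 'v + nat} + card (Inr ` {..<k - 2} :: ('v + nat) set)"
    by (rule card_Un_le)
  also have "\<dots> \<le> 2 + (k - 2)"
    by (intro add_mono) (auto simp: card_image card_insert_if)
  finally show ?thesis
    using assms by simp
qed

text \<open>\<open>has_neighbour\<close> puts every blob into an edge clique, and
  \<open>connected\<close> carries local information about a colour to all blobs. A loop would be a
  degenerate triangle.\<close>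

locale triangle_free_graph =
  fixes U :: "'v set" and R :: "('v \<times> 'v) set"
  assumes finite_U: "finite U"
    and U_nonempty: "U \<noteq> {}"
    and R_subset: "R \<subseteq> U \<times> U"
    and sym_R: "sym R"
    and triangle_free: "(x, y) \<in> R \<Longrightarrow> (y, z) \<in> R \<Longrightarrow> (x, z) \<notin> R"
    and has_neighbour: "x \<in> U \<Longrightarrow> \<exists>y. (x, y) \<in> R"
    and connected: "x \<in> U \<Longrightarrow> y \<in> U \<Longrightarrow> (x, y) \<in> R\<^sup>*"
begin

lemma irrefl_R: "(x, x) \<notin> R"
  using triangle_free by blast

lemma finite_blowup_verts: "finite (blowup_verts k U)"
  using finite_U by (simp add: blowup_verts_def)

lemma blowup_edges_props:
  "blowup_edges k U R \<subseteq> blowup_verts k U \<times> blowup_verts k U"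
  "sym (blowup_edges k U R)" "irrefl (blowup_edges k U R)"
  using sym_R by (auto simp: blowup_edges_def sym_def irrefl_def)

text \<open>The vertices of \<open>U\<close> met by a clique are pairwise adjacent, so there are at
  most two of them; if there are fewer, a neighbour completes an edge.\<close>

lemma clique_subset_edge_clique:
  assumes "clique (blowup_edges k U R) n K" "n \<ge> 2"
  obtains x y where "(x, y) \<in> R" "K \<subseteq> edge_clique k x y"
proof -
  define X where "X = {x. \<exists>t. (Inl x, t) \<in> K}"
  have KV: "K \<subseteq> blowup_verts k U"
    using clique_subset_verts[OF assms blowup_edges_props(1)] .
  then have XU: "X \<subseteq> U"
    by (auto simp: X_def blowup_verts_def blob_def core_def)
  have adj: "x = y \<or> (x, y) \<in> R" if xy: "x \<in> X" "y \<in> X" for x y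
  proof -
    obtain s t where "(Inl x, s) \<in> K" "(Inl y, t) \<in> K"
      using xy by (auto simp: X_def)
    then show ?thesis
      using assms(1) unfolding clique_def blowup_edges_def by fastforce
  qed
  have "\<exists>x y. (x, y) \<in> R \<and> X \<subseteq> {x, y}"
  proof (cases "\<exists>x \<in> X. \<exists>y \<in> X. x \<noteq> y")
    case True
    then obtain x y where xy: "x \<in> X" "y \<in> X" "x \<noteq> y" by blast
    then have "(x, y) \<in> R" using adj by blast
    moreover have "z \<in> {x, y}" if "z \<in> X" for z
      using adj[OF xy(1) that] adj[OF xy(2) that] triangle_free \<open>(x, y) \<in> R\<close> by blast
    ultimately show ?thesis by blast
  next
    case False
    obtain x where "x \<in> U" "X \<subseteq> {x}"
      using False XU U_nonempty by blast
    then show ?thesis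
      using has_neighbour by blast
  qed
  then obtain x y where xy: "(x, y) \<in> R" "X \<subseteq> {x, y}" by blast
  have "p \<in> edge_clique k x y" if "p \<in> K" for p
  proof (cases p)
    case (Pair u t)
    then show ?thesis
      using that KV xy(2)
      by (cases u) (auto simp: X_def edge_clique_def blowup_verts_def blob_def core_def)
  qed
  then show ?thesis
    using that xy(1) by blast
qed

lemma edge_clique_pairwise:
  assumes "(x, y) \<in> R" "p \<in> edge_clique k x y" "q \<in> edge_clique k x y" "p \<noteq> q"
  shows "(p, q) \<in> blowup_edges k U R"
  using assms R_subset sym_R unfolding blowup_edges_def edge_clique_def blowup_verts_def
  by (auto simp: blob_def core_def sym_def)

text \<open>Inside an edge clique, \<open>k + 1\<close> colours give a rainbow clique of
  representatives and \<open>k + 1\<close> vertices of one colour a monochromatic one. Conversely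
  every clique in question lies in an edge clique.\<close>

lemma clique_worm_blowup_iff:
  assumes "k \<ge> 2"
  shows "clique_worm (blowup_edges k U R) (Suc k) c \<longleftrightarrow>
    (\<forall>x y. (x, y) \<in> R \<longrightarrow> card (c ` edge_clique k x y) \<le> k \<and>
      (\<forall>a. card {p \<in> edge_clique k x y. c p = a} \<le> k))"
    (is "?L \<longleftrightarrow> ?R")
proof
  assume L: ?L
  show ?R
  proof (intro allI impI)
    fix x y assume xy: "(x, y) \<in> R"
    let ?Q = "edge_clique k x y"
    have sub: "clique (blowup_edges k U R) (Suc k) K" if "K \<subseteq> ?Q" "card K = Suc k" for K
      using that edge_clique_pairwise[OF xy] card_ge_0_finite[of K]
      unfolding clique_def by (metis subsetD zero_less_Suc)
    have "card (c ` ?Q) \<le> k"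
    proof (rule ccontr)
      assume "\<not> ?thesis"
      then have "Suc k \<le> card (c ` ?Q)" by simp
      then obtain T where T: "T \<subseteq> c ` ?Q" "card T = Suc k"
        by (rule obtain_subset_with_card_n)
      then obtain K where "K \<subseteq> ?Q" "inj_on c K" "T = c ` K"
        using subset_image_inj[of T c ?Q] by blast
      then show False
        using L sub[of K] T(2) unfolding clique_worm_def by (simp add: card_image)
    qed
    moreover have "card {p \<in> ?Q. c p = a} \<le> k" for a
    proof (rule ccontr)
      assume "\<not> ?thesis"
      then have "Suc k \<le> card {p \<in> ?Q. c p = a}" by simp
      then obtain K where K: "K \<subseteq> {p \<in> ?Q. c p = a}" "card K = Suc k"
        by (rule obtain_subset_with_card_n)
      then have "clique (blowup_edges k U R) (Suc k) K"
        by (intro sub) auto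
      moreover have "\<forall>u \<in> K. \<forall>v \<in> K. c u = c v"
        using K(1) by blast
      ultimately show False
        using L unfolding clique_worm_def by blast
    qed
    ultimately show "card (c ` ?Q) \<le> k \<and> (\<forall>a. card {p \<in> ?Q. c p = a} \<le> k)"
      by blast
  qed
next
  assume R: ?R
  show ?L
    unfolding clique_worm_def
  proof (intro allI impI)
    fix K assume K: "clique (blowup_edges k U R) (Suc k) K"
    then obtain x y where xy: "(x, y) \<in> R" "K \<subseteq> edge_clique k x y"
      using clique_subset_edge_clique[of k "Suc k" K] assms by auto
    have card: "card K = Suc k" using K by (simp add: clique_def)
    have "\<not> (\<forall>u \<in> K. \<forall>v \<in> K. c u = c v)"
    proof
      assume mono: "\<forall>u \<in> K. \<forall>v \<in> K. c u = c v"
      obtain u where "u \<in> K" using card by (cases "K = {}") auto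
      then have "K \<subseteq> {p \<in> edge_clique k x y. c p = c u}"
        using mono xy(2) by blast
      then have "card K \<le> card {p \<in> edge_clique k x y. c p = c u}"
        by (intro card_mono) auto
      moreover have "card {p \<in> edge_clique k x y. c p = c u} \<le> k"
        using R xy(1) by blast
      ultimately show False
        using card by simp
    qed
    moreover have "\<not> inj_on c K"
    proof
      assume "inj_on c K"
      then have "Suc k = card (c ` K)" by (simp add: card card_image)
      also have "\<dots> \<le> card (c ` edge_clique k x y)"
        using xy(2) by (intro card_mono) auto
      finally show False
        using R xy(1) by fastforce
    qed
    ultimately show "\<not> (\<forall>u \<in> K. \<forall>v \<in> K. c u = c v) \<and> \<not> inj_on c K" by blast
  qed
qed

section \<open>Two sample colourings: the two sides of the gap\<close>

lemma palette_mem_blowup: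
  assumes "k \<ge> 2"
  shows "k \<in> clique_spectrum (blowup_verts k U) (blowup_edges k U R) (Suc k)"
proof -
  obtain x where x: "x \<in> U" using U_nonempty by blast
  \<comment> \<open>Colouring by copy number makes every blob rainbow with the same \<open>k\<close>
    colours.\<close>
  have "snd ` blowup_verts k U = {..<k}"
    using x by (auto simp: blowup_verts_eq snd_image_times)
  moreover have "clique_worm (blowup_edges k U R) (Suc k) snd"
    unfolding clique_worm_blowup_iff[OF assms]
  proof (intro allI impI conjI)
    fix x y a assume "(x, y) \<in> R"
    have "snd ` edge_clique k x y \<subseteq> {..<k}"
      by (auto simp: edge_clique_def blob_def core_def)
    then show "card (snd ` edge_clique k x y) \<le> k"
      using card_mono[of "{..<k}"] by fastforce
    have "{p \<in> edge_clique k x y. snd p = a} \<subseteq>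
        (\<lambda>u. (u, a)) ` ({Inl x, Inl y} \<union> Inr ` {..<k - 2})"
      by (auto simp: edge_clique_def blob_def core_def)
    then have "card {p \<in> edge_clique k x y. snd p = a} \<le>
        card ((\<lambda>u. (u, a)) ` ({Inl x, Inl y} \<union> Inr ` {..<k - 2}))"
      by (intro card_mono) auto
    also have "\<dots> \<le> card ({Inl x, Inl y} \<union> Inr ` {..<k - 2})"
      by (intro card_image_le) auto
    also have "\<dots> \<le> k"
      by (rule card_base_clique_le[OF assms])
    finally show "card {p \<in> edge_clique k x y. snd p = a} \<le> k" .
  qed
  ultimately show ?thesis
    unfolding clique_spectrum_def by (intro CollectI exI[of _ snd]) simp
qed

text \<open>Each blob receives a colour of its own; this guarantees a value above the gap.\<close>

lemma blob_count_mem_blowup: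
  assumes "k \<ge> 2"
  shows "k - 2 + card U \<in> clique_spectrum (blowup_verts k U) (blowup_edges k U R) (Suc k)"
proof -
  let ?B = "Inl ` U \<union> Inr ` {..<k - 2} :: ('v + nat) set"
  have "finite ?B" using finite_U by simp
  then obtain h :: "'v + nat \<Rightarrow> nat" where h: "inj_on h ?B"
    using finite_imp_inj_to_nat_seg[of ?B] by auto
  have im: "fst ` blowup_verts k U = ?B"
    using assms by (auto simp: blowup_verts_eq fst_image_times lessThan_empty_iff)
  have "card ((h \<circ> fst) ` blowup_verts k U) = card ?B"
    unfolding image_comp[symmetric] im by (rule card_image[OF h])
  also have "\<dots> = k - 2 + card U"
    using finite_U by (subst card_Un_disjoint) (auto simp: card_image)
  finally have "card ((h \<circ> fst) ` blowup_verts k U) = k - 2 + card U" .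
  moreover have "clique_worm (blowup_edges k U R) (Suc k) (h \<circ> fst)"
    unfolding clique_worm_blowup_iff[OF assms]
  proof (intro allI impI conjI)
    fix x y a assume xy: "(x, y) \<in> R"
    let ?W = "{Inl x, Inl y} \<union> Inr ` {..<k - 2}"
    have W: "?W \<subseteq> ?B" using xy R_subset by auto
    have "(h \<circ> fst) ` edge_clique k x y \<subseteq> h ` ?W"
      by (auto simp: edge_clique_def blob_def core_def)
    then have "card ((h \<circ> fst) ` edge_clique k x y) \<le> card (h ` ?W)"
      by (intro card_mono) auto
    also have "\<dots> \<le> card ?W"
      by (intro card_image_le) auto
    also have "\<dots> \<le> k"
      by (rule card_base_clique_le[OF assms])
    finally show "card ((h \<circ> fst) ` edge_clique k x y) \<le> k" .
    have proj: "fst p \<in> ?W" "snd p < k" if "p \<in> edge_clique k x y" for p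
      using that by (auto simp: edge_clique_def blob_def core_def)
    have "\<exists>u. {p \<in> edge_clique k x y. (h \<circ> fst) p = a} \<subseteq> {u} \<times> {..<k}"
    proof (cases "\<exists>u \<in> ?W. a = h u")
      case True
      then obtain u where u: "u \<in> ?W" "a = h u" by blast
      have "p \<in> {u} \<times> {..<k}" if p: "p \<in> edge_clique k x y" "(h \<circ> fst) p = a" for p
      proof -
        have "fst p = u"
          using inj_onD[OF h, of "fst p" u] proj(1)[OF p(1)] p(2) u W by auto
        then show ?thesis
          using proj(2)[OF p(1)] by (cases p) simp
      qed
      then show ?thesis by blast
    next
      case False
      then have "{p \<in> edge_clique k x y. (h \<circ> fst) p = a} = {}"
        using proj(1) by fastforce
      then show ?thesis by (simp only: empty_subsetI simp_thms)
    qed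
    then obtain u where "{p \<in> edge_clique k x y. (h \<circ> fst) p = a} \<subseteq> {u} \<times> {..<k}" by blast
    then have "card {p \<in> edge_clique k x y. (h \<circ> fst) p = a} \<le> card ({u} \<times> {..<k})"
      by (intro card_mono) auto
    then show "card {p \<in> edge_clique k x y. (h \<circ> fst) p = a} \<le> k"
      by (simp add: card_cartesian_product)
  qed
  ultimately show ?thesis
    unfolding clique_spectrum_def by (intro CollectI exI[of _ "h \<circ> fst"]) simp
qed

text \<open>Case distinction on the number of core colours, which lies between \<open>k - 2\<close>
  and \<open>k\<close>. \<open>M\<close> is a strict lower bound for the number of colours in proper
  colourings of the triangle-free graph.\<close>

lemma blowup_worm_card:
  assumes k: "k \<ge> 2" and worm: "clique_worm (blowup_edges k U R) (Suc k) c"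
    and M: "M \<ge> 2"
    and chromatic: "\<And>f :: 'v \<Rightarrow> nat. (\<And>x y. (x, y) \<in> R \<Longrightarrow> f x \<noteq> f y) \<Longrightarrow> M < card (f ` U)"
  shows "card (c ` blowup_verts k U) = k \<or> k - 2 + M < card (c ` blowup_verts k U)"
proof -
  \<comment> \<open>\<open>D\<close> is the palette of the core, \<open>N x\<close> the colours of a
    blob outside it, and \<open>cnt a x\<close> the multiplicity of a colour on a blob.\<close>
  define D where "D = c ` (core k :: (('v + nat) \<times> nat) set)"
  define N where "N x = c ` blob k x - D" for x
  define cnt where "cnt a x = card {p \<in> blob k x. c p = a}" for a x
  have [simp]: "finite D" "finite (N x)" for x
    by (auto simp: D_def N_def)
  have V: "c ` blowup_verts k U = D \<union> (\<Union>x \<in> U. N x)"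
    by (auto simp: blowup_verts_def D_def N_def)
  have in_U: "x \<in> U" "y \<in> U" if "(x, y) \<in> R" for x y
    using that R_subset by auto
  have cnt_pos: "0 < cnt a x \<longleftrightarrow> a \<in> c ` blob k x" for a x
    by (auto simp: cnt_def card_gt_0_iff)
  have cnt_two: "cnt b x < k" if "a \<in> c ` blob k x" "a \<noteq> b" for a b x
  proof -
    have "{p \<in> blob k x. c p = b} \<subset> blob k x"
      using that by blast
    then have "card {p \<in> blob k x. c p = b} < card (blob k x)"
      by (intro psubset_card_mono) auto
    then show ?thesis by (simp add: cnt_def)
  qed
  have fibre_le: "card {p \<in> edge_clique k x y. c p = a} \<le> k"
    and colours_le: "card (c ` edge_clique k x y) \<le> k" if "(x, y) \<in> R" for x y a
    using worm that unfolding clique_worm_blowup_iff[OF k] by auto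
  have Q_card: "card (edge_clique k x y) = k * k" if "(x, y) \<in> R" for x y
    using that irrefl_R card_edge_clique[OF _ k, of x y] by blast
  \<comment> \<open>With \<open>k * k\<close> vertices, classes of size at most \<open>k\<close> and
    at most \<open>k\<close> colours, both bounds are attained.\<close>
  have colours: "card (c ` edge_clique k x y) = k" if "(x, y) \<in> R" for x y
    using card_le_fibre_bound[of "edge_clique k x y" c k] fibre_le[OF that] colours_le[OF that]
      Q_card[OF that] k by simp
  have fibre: "card {p \<in> edge_clique k x y. c p = a} = k"
    if "(x, y) \<in> R" "a \<in> c ` edge_clique k x y" for x y a
    using fibres_full[of "edge_clique k x y" c k a] fibre_le[OF that(1)] colours[OF that(1)]
      Q_card[OF that(1)] that(2) by simp
  have palette: "card D + card (N x \<union> N y) = k" if "(x, y) \<in> R" for x y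
  proof -
    have "c ` edge_clique k x y = D \<union> (N x \<union> N y)" "D \<inter> (N x \<union> N y) = {}"
      by (auto simp: edge_clique_def D_def N_def)
    then show ?thesis
      using colours[OF that] by (simp add: card_Un_disjoint)
  qed
  \<comment> \<open>A colour absent from the core has its whole class of size \<open>k\<close> in
    the two blobs.\<close>
  have cnt_sum: "cnt a x + cnt a y = k" if "(x, y) \<in> R" "a \<in> N x" for a x y
  proof -
    have "{p \<in> edge_clique k x y. c p = a} = {p \<in> blob k x. c p = a} \<union> {p \<in> blob k y. c p = a}"
    proof -
      have "c p \<noteq> a" if "p \<in> core k" for p
        using that \<open>a \<in> N x\<close> unfolding N_def D_def by blast
      then show ?thesis by (auto simp: edge_clique_def)
    qed
    moreover have "x \<noteq> y" using that(1) irrefl_R by blast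
    then have "{p \<in> blob k x. c p = a} \<inter> {p \<in> blob k y. c p = a} = {}"
      using blob_blob_disjoint by fastforce
    moreover have "a \<in> c ` edge_clique k x y"
      using that(2) by (auto simp: edge_clique_def N_def)
    ultimately show ?thesis
      using fibre[OF that(1), of a] by (simp add: cnt_def card_Un_disjoint)
  qed
  obtain x0 y0 where e0: "(x0, y0) \<in> R"
    using U_nonempty has_neighbour by blast
  have core_fibre: "card {p \<in> core k. c p = a} \<le> k" for a
  proof -
    have "card {p \<in> core k. c p = a} \<le> card {p \<in> edge_clique k x0 y0. c p = a}"
      by (intro card_mono) (auto simp: edge_clique_def)
    then show ?thesis using fibre_le[OF e0, of a] by simp
  qed
  have "k * (k - 2) \<le> k * card D"
    using card_le_fibre_bound[OF finite_core, of k c k] core_fibre by (simp add: D_def)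
  then have D_ge: "k - 2 \<le> card D" using k by simp
  \<comment> \<open>With only \<open>k - 2\<close> colours the core already fills each of its
    classes, so one more vertex in a blob would make a class too large.\<close>
  have no_core_colour: "c ` blob k x \<inter> D = {}" if "card D = k - 2" "x \<in> U" for x
  proof (rule ccontr)
    assume "\<not> ?thesis"
    then obtain p where p: "p \<in> blob k x" "c p \<in> D" by blast
    obtain y where e: "(x, y) \<in> R" using has_neighbour \<open>x \<in> U\<close> by blast
    have "card {q \<in> core k. c q = c p} = k"
      using fibres_full[OF finite_core, of k c k "c p"] core_fibre that(1) p(2)
      by (simp add: D_def)
    moreover have "{q \<in> core k. c q = c p} \<subset> {q \<in> edge_clique k x y. c q = c p}"
      using p blob_core_disjoint[of k x] by (auto simp: edge_clique_def)
    then have "card {q \<in> core k. c q = c p} < card {q \<in> edge_clique k x y. c q = c p}"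
      by (intro psubset_card_mono) auto
    ultimately show False
      using fibre_le[OF e, of "c p"] by simp
  qed
  \<comment> \<open>By \<open>cnt_sum\<close>, a multiplicity strictly between \<open>0\<close> and
    \<open>k\<close> at one end of an edge forces the same at the other; induction along a path does
    the rest.\<close>
  have spread: "a \<in> N y \<and> cnt a y < k" if "a \<in> N x" "cnt a x < k" "x \<in> U" "y \<in> U" for a x y
    using connected[OF that(3,4)]
  proof (induction rule: rtrancl_induct)
    case base
    then show ?case using that by blast
  next
    case (step y z)
    then have "cnt a y + cnt a z = k" "0 < cnt a y" "cnt a y < k"
      using cnt_sum[of y z a] cnt_pos[of a y] by (auto simp: N_def)
    then show ?case
      using cnt_pos[of a z] step.IH by (auto simp: N_def)
  qed
  \<comment> \<open>If all blobs share the same colours outside the core, the palette of one edge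
    clique is the palette of the whole graph.\<close>
  have constant_N: ?thesis if "\<And>x. x \<in> U \<Longrightarrow> N x = T" for T
  proof -
    have "c ` blowup_verts k U = D \<union> T"
      using that U_nonempty unfolding V by blast
    moreover have "D \<inter> T = {}"
      using that[OF in_U(1)[OF e0]] by (auto simp: N_def)
    moreover have "finite T" using that[OF in_U(1)[OF e0]] \<open>finite (N x0)\<close> by simp
    ultimately have "card (c ` blowup_verts k U) = card D + card T"
      by (simp add: card_Un_disjoint)
    then show ?thesis
      using palette[OF e0] that in_U[OF e0] by simp
  qed
  have "card D \<le> k" using palette[OF e0] by simp
  then consider "card D = k" | "card D = k - 1" "card D \<noteq> k" | "card D = k - 2" "card D \<noteq> k - 1"
    using D_ge by linarith
  then show ?thesis
  proof cases
    case 1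
    have "N x = {}" if x: "x \<in> U" for x
    proof -
      obtain y where "(x, y) \<in> R" using has_neighbour x by blast
      then show ?thesis using palette[of x y] 1 by simp
    qed
    then show ?thesis by (rule constant_N)
  next
    case 2
    \<comment> \<open>Each edge sees exactly one colour outside the core. If it covers some blob
      only partly it spreads to all of them.\<close>
    have one: "card (N x \<union> N y) = 1" if "(x, y) \<in> R" for x y
      using palette[OF that] 2 k by simp
    show ?thesis
    proof (cases "\<exists>x \<in> U. \<exists>a \<in> N x. cnt a x < k")
      case True
      then obtain x1 a where a: "x1 \<in> U" "a \<in> N x1" "cnt a x1 < k" by blast
      have "N x = {a}" if x: "x \<in> U" for x
      proof -
        obtain y where "(x, y) \<in> R" using has_neighbour x by blast
        then have "N x \<subseteq> {b}" if "N x \<union> N y = {b}" for b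
          using that by auto
        then obtain b where "N x \<subseteq> {b}"
          using one[OF \<open>(x, y) \<in> R\<close>] card_1_singletonE by metis
        moreover have "a \<in> N x" using spread[OF a(2,3,1) x] by blast
        ultimately show ?thesis by blast
      qed
      then show ?thesis by (rule constant_N)
    next
      case False
      \<comment> \<open>Now every colour outside the core fills its blob, so exactly one end of each
        edge has such a colour. This would be a proper 2-colouring, against
        \<open>M \<ge> 2\<close>.\<close>
      define f :: "'v \<Rightarrow> nat" where "f x = (if N x = {} then 0 else 1)" for x
      have "f x \<noteq> f y" if e: "(x, y) \<in> R" for x y
      proof
        assume "f x = f y"
        then have same: "N x = {} \<longleftrightarrow> N y = {}"
          by (simp add: f_def split: if_splits)
        obtain a where "N x \<union> N y = {a}"
          using one[OF e] by (rule card_1_singletonE)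
        then have a: "a \<in> N x" "a \<in> N y"
          using same by auto
        then have "0 < cnt a x" "0 < cnt a y"
          unfolding cnt_pos N_def by blast+
        then have "cnt a x < k"
          using cnt_sum[OF e a(1)] by simp
        then show False using False a(1) in_U[OF e] by blast
      qed
      then have "M < card (f ` U)" by (rule chromatic)
      moreover have "f ` U \<subseteq> {0, 1}" by (auto simp: f_def)
      then have "card (f ` U) \<le> 2" using card_mono[of "{0, 1 :: nat}" "f ` U"] by simp
      ultimately show ?thesis using M by simp
    qed
  next
    case 3
    have two: "card (N x \<union> N y) = 2" if "(x, y) \<in> R" for x y
      using palette[OF that] 3 k by simp
    have N_blob: "N x = c ` blob k x" if "x \<in> U" for x
      using no_core_colour[OF 3(1) that] by (auto simp: N_def)
    show ?thesis
    proof (cases "\<exists>x \<in> U. \<exists>a \<in> N x. cnt a x < k")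
      case True
      then obtain x1 a where a: "x1 \<in> U" "a \<in> N x1" "cnt a x1 < k" by blast
      \<comment> \<open>A partly used colour leaves room for a second colour \<open>b\<close> on the
        same blob, again partly used and outside the core. Both spread and exhaust the two colours
        allowed on each edge.\<close>
      have "{p \<in> blob k x1. c p = a} \<noteq> blob k x1"
        using a(3) by (metis card_blob cnt_def less_irrefl)
      then obtain b where b: "b \<in> c ` blob k x1" "b \<noteq> a" by blast
      have bN: "b \<in> N x1" using b(1) N_blob[OF a(1)] by simp
      have bk: "cnt b x1 < k" using cnt_two[of a x1 b] a(2) b(2) by (simp add: N_def)
      have "N x = {a, b}" if x: "x \<in> U" for x
      proof -
        obtain y where e: "(x, y) \<in> R" using has_neighbour x by blast
        have "{a, b} \<subseteq> N x"
          using spread[OF a(2,3,1) x] spread[OF bN bk a(1) x] by blast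
        moreover have "N x \<union> N y = {a, b}"
          using two[OF e] b(2) calculation
          by (intro card_subset_eq[symmetric]) auto
        ultimately show ?thesis by blast
      qed
      then show ?thesis by (rule constant_N)
    next
      case False
      \<comment> \<open>All blobs are monochromatic, so copy \<open>0\<close> represents its blob
        and \<open>f\<close> is a proper colouring avoiding \<open>D\<close>.\<close>
      define f where "f x = c (Inl x, 0)" for x
      have f_in: "f x \<in> c ` blob k x" for x
        using k by (auto simp: f_def blob_def)
      have N_single: "N x = {f x}" if x: "x \<in> U" for x
        using False cnt_two[of _ x "f x"] f_in[of x] N_blob[OF x] x by blast
      have "f x \<noteq> f y" if e: "(x, y) \<in> R" for x y
        using two[OF e] N_single in_U[OF e] by auto
      then have "M < card (f ` U)" by (rule chromatic)
      moreover have "c ` blowup_verts k U = D \<union> f ` U"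
        unfolding V using N_single by auto
      moreover have "D \<inter> f ` U = {}"
        using no_core_colour[OF 3(1)] f_in by blast
      ultimately show ?thesis
        using 3(1) finite_U by (auto simp: card_Un_disjoint)
    qed
  qed
qed

end


section \<open>Shift graphs\<close>

text \<open>The pair \<open>(0, N - 1)\<close> would be an isolated vertex.\<close>

definition shift_verts :: "nat \<Rightarrow> (nat \<times> nat) set" where
  "shift_verts N = {(i, j). i < j \<and> j < N} - {(0, N - 1)}"

definition shift_edges :: "nat \<Rightarrow> ((nat \<times> nat) \<times> (nat \<times> nat)) set" where
  "shift_edges N = {(p, q). p \<in> shift_verts N \<and> q \<in> shift_verts N \<and>
     (snd p = fst q \<or> snd q = fst p)}"

lemma shift_vertsE:
  assumes "p \<in> shift_verts N"
  obtains i j where "p = (i, j)" "i < j" "j < N" "i \<noteq> 0 \<or> j \<noteq> N - 1"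
  using assms by (cases p) (auto simp: shift_verts_def)

text \<open>Adjacent pairs are intervals meeting end to end, and three intervals cannot do so
  pairwise. For connectedness every vertex is led to \<open>(1, N - 1)\<close>, first moving up to a
  pair ending at \<open>N - 1\<close>, then down through \<open>(0, 1)\<close>.\<close>

lemma triangle_free_graph_shift:
  assumes "N \<ge> 4"
  shows "triangle_free_graph (shift_verts N) (shift_edges N)"
proof
  have "shift_verts N \<subseteq> {..<N} \<times> {..<N}"
    by (auto simp: shift_verts_def)
  then show "finite (shift_verts N)"
    by (rule finite_subset) simp
  have "(0, 1) \<in> shift_verts N"
    using assms by (auto simp: shift_verts_def)
  then show "shift_verts N \<noteq> {}" by blast
  show "shift_edges N \<subseteq> shift_verts N \<times> shift_verts N"
    by (auto simp: shift_edges_def)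
  show sym: "sym (shift_edges N)"
    by (auto simp: shift_edges_def sym_def)
  fix x y z
  show "(x, z) \<notin> shift_edges N" if "(x, y) \<in> shift_edges N" "(y, z) \<in> shift_edges N"
    using that by (cases x; cases y; cases z) (auto simp: shift_edges_def shift_verts_def)
  have to_top: "(x, (j, N - 1)) \<in> shift_edges N" if "x = (i, j)" "i < j" "j < N - 1" for x i j
    using that by (auto simp: shift_edges_def shift_verts_def)
  have reach: "(x, (1, N - 1)) \<in> (shift_edges N)\<^sup>*" if x: "x \<in> shift_verts N" for x
  proof -
    have top: "((j, N - 1), (1, N - 1)) \<in> (shift_edges N)\<^sup>*" if j: "0 < j" "j < N - 1" for j
    proof (cases "j = 1")
      case False
      have "((j, N - 1), (1, j)) \<in> shift_edges N" "((1, j), (0, 1)) \<in> shift_edges N"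
          "((0, 1), (1, N - 1)) \<in> shift_edges N"
        using j False assms by (auto simp: shift_edges_def shift_verts_def)
      then show ?thesis
        by (meson r_into_rtrancl rtrancl_trans)
    qed simp
    obtain i j where ij: "x = (i, j)" "i < j" "j < N" "i \<noteq> 0 \<or> j \<noteq> N - 1"
      using x by (rule shift_vertsE)
    show ?thesis
    proof (cases "j = N - 1")
      case True
      then show ?thesis using top[of i] ij by simp
    next
      case False
      then have "(x, (j, N - 1)) \<in> shift_edges N" "0 < j" "j < N - 1"
        using to_top ij by auto
      then show ?thesis
        using top[of j] by (meson converse_rtrancl_into_rtrancl)
    qed
  qed
  show "(x, y) \<in> (shift_edges N)\<^sup>*" if "x \<in> shift_verts N" "y \<in> shift_verts N"
    using reach[OF that(1)] reach[OF that(2)] sym_rtrancl[OF sym]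
    by (meson rtrancl_trans symD)
  show "\<exists>y. (x, y) \<in> shift_edges N" if x: "x \<in> shift_verts N"
  proof -
    obtain i j where ij: "x = (i, j)" "i < j" "j < N" "i \<noteq> 0 \<or> j \<noteq> N - 1"
      using x by (rule shift_vertsE)
    show ?thesis
    proof (cases "j = N - 1")
      case True
      then have "(x, (0, i)) \<in> shift_edges N"
        using ij by (auto simp: shift_edges_def shift_verts_def)
      then show ?thesis by blast
    next
      case False
      then show ?thesis using to_top[OF ij(1,2)] ij(3) by fastforce
    qed
  qed
qed

text \<open>
  The colour of \<open>(i, j)\<close> separates the set of colours used on pairs starting at \<open>i\<close>
  from the set of those used on pairs starting at \<open>j\<close>, so these sets are pairwise distinct.
\<close>

lemma shift_graph_colours:
  fixes f :: "nat \<times> nat \<Rightarrow> nat"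
  assumes proper: "\<And>p q. (p, q) \<in> shift_edges (2 ^ M + 2) \<Longrightarrow> f p \<noteq> f q"
  shows "M < card (f ` shift_verts (2 ^ M + 2))"
proof -
  define N :: nat where "N = 2 ^ M + 2"
  define S where "S i = {f (i, j) | j. i < j \<and> j < N}" for i
  have "shift_verts N \<subseteq> {..<N} \<times> {..<N}"
    by (auto simp: shift_verts_def)
  then have fin: "finite (f ` shift_verts N)"
    using finite_subset by blast
  \<comment> \<open>Index \<open>0\<close> is left out because \<open>S 0\<close> also contains the
    colour of the deleted pair \<open>(0, N - 1)\<close>.\<close>
  have neq: "S i \<noteq> S j" if ij: "1 \<le> i" "i < j" "j < N" for i j
  proof -
    have "f (i, j) \<in> S i"
      using ij by (auto simp: S_def)
    moreover have "f (i, j) \<notin> S j"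
    proof
      assume "f (i, j) \<in> S j"
      then obtain m where m: "j < m" "m < N" "f (i, j) = f (j, m)"
        by (auto simp: S_def)
      then have "((i, j), (j, m)) \<in> shift_edges N"
        using ij by (auto simp: shift_edges_def shift_verts_def)
      then show False
        using proper m(3) by (simp add: N_def)
    qed
    ultimately show ?thesis by blast
  qed
  have "inj_on S {1..<N}"
  proof (rule inj_onI)
    fix i j assume "i \<in> {1..<N}" "j \<in> {1..<N}" "S i = S j"
    then show "i = j"
      using neq[of i j] neq[of j i] by (cases i j rule: linorder_cases) auto
  qed
  moreover have "S ` {1..<N} \<subseteq> Pow (f ` shift_verts N)"
    by (auto simp: S_def shift_verts_def)
  ultimately have "card {1..<N} \<le> card (Pow (f ` shift_verts N))"
    using fin by (intro card_inj_on_le) auto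
  \<comment> \<open>There are \<open>N - 1 = 2 ^ M + 1\<close> distinct sets, one more than
    \<open>M\<close> colours have subsets.\<close>
  then have "N - 1 \<le> 2 ^ card (f ` shift_verts N)"
    using fin by (simp add: card_Pow)
  moreover have "2 ^ M < N - 1"
    by (simp add: N_def)
  ultimately have "(2::nat) ^ M < 2 ^ card (f ` shift_verts N)"
    by linarith
  then show ?thesis
    unfolding N_def[symmetric] by (rule power_less_imp_less_exp[rotated]) simp
qed

section \<open>Gaps\<close>

text \<open>Both neighbours of the run belong to \<open>S\<close>, which makes the run maximal and
  places it between minimum and maximum.\<close>

definition spectrum_gap :: "nat set \<Rightarrow> nat \<Rightarrow> bool" where
  "spectrum_gap S l \<longleftrightarrow> (\<exists>a. a \<in> S \<and> a + l + 1 \<in> S \<and> (\<forall>s \<in> S. s \<le> a \<or> a + l < s))"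

text \<open>The shifted copy fills the lowest missing number \<open>a + 1\<close>, while its own gap
  ends one above the old upper end, which stays put.\<close>

lemma spectrum_gap_Un_Suc:
  assumes "spectrum_gap S (Suc l)"
  shows "spectrum_gap (S \<union> Suc ` S) l"
proof -
  obtain a where a: "a \<in> S" "a + Suc l + 1 \<in> S" "\<forall>s \<in> S. s \<le> a \<or> a + Suc l < s"
    using assms unfolding spectrum_gap_def by blast
  then show ?thesis
    unfolding spectrum_gap_def
    by (intro exI[of _ "Suc a"]) auto
qed

text \<open>Nonemptiness is included for \<open>clique_spectrum_insert\<close>.\<close>

definition simple_graph :: "'a set \<Rightarrow> ('a \<times> 'a) set \<Rightarrow> bool" where
  "simple_graph V E \<longleftrightarrow> finite V \<and> V \<noteq> {} \<and> E \<subseteq> V \<times> V \<and> sym E \<and> irrefl E"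

lemma spectrum_gap_decrease:
  assumes "L \<ge> l" "n \<ge> 2" "simple_graph V (E :: (nat \<times> nat) set)"
    "spectrum_gap (clique_spectrum V E n) L"
  shows "\<exists>V' :: nat set. simple_graph V' E \<and> spectrum_gap (clique_spectrum V' E n) l"
  using assms(1,3,4)
proof (induction "L - l" arbitrary: V L)
  case 0
  then show ?case by (metis diff_is_0_eq le_antisym)
next
  case (Suc d)
  then obtain L' where L': "L = Suc L'" "d = L' - l" "l \<le> L'"
    by (cases L) auto
  have V: "finite V" "V \<noteq> {}" "E \<subseteq> V \<times> V" "sym E" "irrefl E"
    using Suc.prems(2) by (auto simp: simple_graph_def)
  obtain v where v: "v \<notin> V"
    using V(1) ex_new_if_finite[OF infinite_UNIV_nat] by blast
  have "spectrum_gap (clique_spectrum (insert v V) E n) L'"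
    using spectrum_gap_Un_Suc Suc.prems(3) clique_spectrum_insert[OF V(1) v V(3) assms(2) V(2)] L'(1)
    by simp
  moreover have "simple_graph (insert v V) E"
    using V by (auto simp: simple_graph_def)
  ultimately show ?case
    using Suc.hyps(1)[OF L'(2,3)] by blast
qed

lemma ex_large_spectrum_gap:
  assumes "k \<ge> 2"
  shows "\<exists>(V :: nat set) E L. L \<ge> l \<and> simple_graph V E \<and>
    spectrum_gap (clique_spectrum V E (Suc k)) L"
proof -
  \<comment> \<open>Counts other than \<open>k\<close> then exceed
    \<open>k - 2 + M = k + l + 1\<close>.\<close>
  define M where "M = l + 3"
  define N :: nat where "N = 2 ^ M + 2"
  have "(2::nat) ^ 1 \<le> 2 ^ M"
    unfolding M_def by (intro power_increasing) auto
  then have "N \<ge> 4" by (simp add: N_def)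
  then interpret triangle_free_graph "shift_verts N" "shift_edges N"
    by (rule triangle_free_graph_shift)
  let ?V = "blowup_verts k (shift_verts N)" and ?E = "blowup_edges k (shift_verts N) (shift_edges N)"
  define S where "S = clique_spectrum ?V ?E (Suc k)"
  have chromatic: "M < card (f ` shift_verts N)"
    if "\<And>x y. (x, y) \<in> shift_edges N \<Longrightarrow> f x \<noteq> f y" for f :: "nat \<times> nat \<Rightarrow> nat"
    using shift_graph_colours[of M f] that unfolding N_def by blast
  have S: "s = k \<or> k - 2 + M < s" if "s \<in> S" for s
    using that blowup_worm_card[OF assms _ _ chromatic] unfolding S_def clique_spectrum_def
    by (auto simp: M_def)
  \<comment> \<open>An injective colouring is proper, so the chromatic bound also bounds the number
    of vertices, and the colouring by blobs uses more than \<open>k\<close> colours.\<close>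
  have "M < card (prod_encode ` shift_verts N)"
    using irrefl_R by (intro chromatic) auto
  then have big: "k - 2 + card (shift_verts N) \<in> S" "k < k - 2 + card (shift_verts N)"
    using blob_count_mem_blowup[OF assms] assms
    by (auto simp: S_def M_def card_image inj_prod_encode)
  \<comment> \<open>The upper end of the gap; its exact value is irrelevant, since isolated vertices
    shorten the gap later.\<close>
  define d where "d = (LEAST s. s \<in> S \<and> k < s)"
  have d: "d \<in> S" "k < d"
    using LeastI[of "\<lambda>s. s \<in> S \<and> k < s"] big unfolding d_def by blast+
  have d_le: "d \<le> s" if "s \<in> S" "k < s" for s
    unfolding d_def using that by (intro Least_le) simp
  have "k + l + 1 < d"
    using S[OF d(1)] d(2) assms by (simp add: M_def)
  moreover have "spectrum_gap S (d - k - 1)"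
    unfolding spectrum_gap_def
    using palette_mem_blowup[OF assms] d d_le by (intro exI[of _ k]) (force simp: S_def)
  moreover have "clique_spectrum (to_nat ` ?V) (map_prod to_nat to_nat ` ?E) (Suc k) = S"
    unfolding S_def using assms by (intro clique_spectrum_image) auto
  moreover have "simple_graph (to_nat ` ?V) (map_prod to_nat to_nat ` ?E)"
  proof -
    have "?V \<noteq> {}"
      using U_nonempty assms by (auto simp: blowup_verts_eq lessThan_empty_iff)
    then show ?thesis
      using finite_blowup_verts blowup_edges_props[of k]
      by (auto simp: simple_graph_def sym_def irrefl_def)
  qed
  ultimately show ?thesis
    by (intro exI[of _ "to_nat ` ?V"] exI[of _ "map_prod to_nat to_nat ` ?E"]
        exI[of _ "d - k - 1"]) auto
qed


section \<open>From spectra back to graphs\<close>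

lemma has_gap_of_size_if_spectrum_gap:
  assumes "graph G" "spectrum_gap (worm_spectrum G F) l"
  shows "has_gap_of_size G F l"
proof -
  let ?S = "worm_spectrum G F"
  obtain a where a: "a \<in> ?S" "a + l + 1 \<in> ?S" "\<forall>s \<in> ?S. s \<le> a \<or> a + l < s"
    using assms(2) unfolding spectrum_gap_def by blast
  have fin: "finite ?S" by (rule finite_worm_spectrum[OF assms(1)])
  have "worm_min G F \<le> a" "a + l + 1 \<le> worm_max G F"
    unfolding worm_min_def worm_max_def using fin a by auto
  then have "gap_at G F i" if "i \<in> {a<..a + l}" for i
    using that a(3) unfolding gap_at_def by fastforce
  then show ?thesis
    unfolding has_gap_of_size_def using a(1,2) by (intro exI[of _ a]) (auto simp: gap_at_def)
qed

theorem theorem4: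
  fixes n l :: nat
  assumes "n \<ge> 3" and "l \<ge> 1"
  shows "\<exists>G :: (nat, nat \<times> nat) pre_digraph.
    graph G \<and> worm_colorable G (complete_graph n) \<and> has_gap_of_size G (complete_graph n) l"
proof -
  obtain k where k: "n = Suc k" "k \<ge> 2"
    using assms(1) by (cases n) auto
  obtain V :: "nat set" and E where VE: "simple_graph V E" "spectrum_gap (clique_spectrum V E n) l"
    using ex_large_spectrum_gap[OF k(2), of l] spectrum_gap_decrease[of l _ n] k by fastforce
  let ?G = "with_proj \<lparr>pverts = V, parcs = E\<rparr>"
  have G: "graph ?G"
    using VE(1) unfolding simple_graph_def by (intro graph_with_projI) auto
  have S: "spectrum_gap (worm_spectrum ?G (complete_graph n)) l"
    using VE worm_spectrum_with_proj[of n E V] k by (simp add: simple_graph_def)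
  then have "worm_spectrum ?G (complete_graph n) \<noteq> {}"
    by (auto simp: spectrum_gap_def)
  then have "worm_colorable ?G (complete_graph n)"
    by (simp only: worm_spectrum_nonempty_iff)
  moreover have "has_gap_of_size ?G (complete_graph n) l"
    using G S by (rule has_gap_of_size_if_spectrum_gap)
  ultimately show ?thesis using G by blast
qed

end
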